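(* Let $\mathbf{A}$ be a complete BL-chain, $W\neq\emptyset$ a set, and consider the BL-algebra $\mathbf{A}^W$ of functions $W\to A$ with pointwise operations. Suppose $\mathcal{A}=\langle A^W,\forall,\exists\rangle$ is a c-EBL-algebra with focal element $c\in A^W$ such that $\sup_{w\in W}c(w)=1$ and $\forall A^W=A^*$, where $A^*$ is the set of constant maps $W\to A$. Then $\mathcal{P}^{\mathcal{A}}=\langle W,c\rangle$ is a possibilistic $\mathbf{A}$-frame, and its associated complex operators satisfy $\forall^{\mathcal{P}^{\mathcal{A}}}=\forall$ and $\exists^{\mathcal{P}^{\mathcal{A}}}=\exists$.
   Context: A BL-algebra is an algebra $\langle A,\wedge,\vee,\ast,\to,0,1\rangle$ such that $\langle A,\wedge,\vee,0,1\rangle$ is a bounded lattice (order $\le$), $\langle A,\ast,1\rangle$ is a commutative monoid, $a\ast b\le c$ iff $a\le b\to c$, and $a\wedge b=a\ast(a\to b)$ and $(a\to b)\vee(b\to a)=1$ hold. A BL-chain is a totally ordered BL-algebra; complete means every subset has a supremum and an infimum. An Epistemic BL-algebra (EBL-algebra) is a BL-algebra with unary operations $\forall,\exists$ satisfying, for all $a,b$: $\forall 1=1$; $\exists 0=0$; $\forall a\to\exists a=1$; $\forall(a\to\forall b)=\exists a\to\forall b$; $\forall(\forall a\to b)=\forall a\to\forall b$; $\exists a\to\forall\exists a=1$; $\forall(a\wedge b)=\forall a\wedge\forall b$; $\exists(a\vee b)=\exists a\vee\exists b$; $\exists(a\ast\exists b)=\exists a\ast\exists b$. The focal element is the least element of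 $\{a:\forall a=1\}$ when it exists; a c-EBL-algebra is an EBL-algebra in which the focal element exists. A possibilistic $\mathbf{A}$-frame is a pair $\langle W,\pi\rangle$ with $W\neq\emptyset$ and $\pi:W\to A$ with $\sup_{w\in W}\pi(w)=1$; for such a frame $\mathcal{P}$ and $f\in A^W$, $\forall^{\mathcal{P}}f$ is the constant function with value $\inf_{w\in W}\{\pi(w)\to f(w)\}$ and $\exists^{\mathcal{P}}f$ is the constant function with value $\sup_{w\in W}\{\pi(w)\ast f(w)\}$. *)

theory Defs
  imports Main "HOL-Library.Function_Algebras"
begin

text \<open>
  BL-algebras as a type class. The lattice operations, the order and the bounds are those of
  \<^class>\<open>bounded_lattice\<close>, so the constant $0$ is \<^term>\<open>bot\<close>; the constant $1$ is the monoid unit,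
  which is required to be the top element.
\<close>

class bl_algebra = bounded_lattice + comm_monoid_mult +
  fixes residuum :: "'a \<Rightarrow> 'a \<Rightarrow> 'a"  (infixr "\<leadsto>" 60)
  assumes one_is_top: "1 = top"
    and residuation: "a * b \<le> c \<longleftrightarrow> a \<le> (b \<leadsto> c)"
    and divisibility: "inf a b = a * (a \<leadsto> b)"
    and prelinearity: "sup (a \<leadsto> b) (b \<leadsto> a) = 1"

class complete_bl_chain = complete_linorder + bl_algebra

text \<open>
  The power $A^W$ is the type \<^typ>\<open>'w \<Rightarrow> 'a\<close>. Its lattice structure is the pointwise one of
  \<^theory>\<open>Main\<close>, its monoid structure the pointwise one of \<^theory>\<open>HOL-Library.Function_Algebras\<close>.
\<close>

instantiation "fun" :: (type, bl_algebra) bl_algebra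
begin

definition residuum_fun :: "('a \<Rightarrow> 'b) \<Rightarrow> ('a \<Rightarrow> 'b) \<Rightarrow> 'a \<Rightarrow> 'b" where
  "residuum_fun f g = (\<lambda>w. f w \<leadsto> g w)"

instance
proof
  fix a b c :: "'a \<Rightarrow> 'b"
  show "(1 :: 'a \<Rightarrow> 'b) = top"
    by (simp add: fun_eq_iff one_is_top)
  show "a * b \<le> c \<longleftrightarrow> a \<le> (b \<leadsto> c)"
    by (simp add: le_fun_def residuum_fun_def residuation)
  show "inf a b = a * (a \<leadsto> b)"
    by (simp add: fun_eq_iff residuum_fun_def divisibility)
  show "sup (a \<leadsto> b) (b \<leadsto> a) = 1"
    by (simp add: fun_eq_iff residuum_fun_def prelinearity)
qed

end

locale ebl_algebra =
  fixes fa ex :: "'a::bl_algebra \<Rightarrow> 'a"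
  assumes fa_one: "fa 1 = 1"
    and ex_zero: "ex bot = bot"
    and fa_imp_ex: "(fa a \<leadsto> ex a) = 1"
    and fa_imp_fa: "fa (a \<leadsto> fa b) = (ex a \<leadsto> fa b)"
    and fa_fa_imp: "fa (fa a \<leadsto> b) = (fa a \<leadsto> fa b)"
    and ex_imp_fa_ex: "(ex a \<leadsto> fa (ex a)) = 1"
    and fa_inf: "fa (inf a b) = inf (fa a) (fa b)"
    and ex_sup: "ex (sup a b) = sup (ex a) (ex b)"
    and ex_mult_ex: "ex (a * ex b) = ex a * ex b"

definition is_focal_element :: "('a::bl_algebra \<Rightarrow> 'a) \<Rightarrow> 'a \<Rightarrow> bool" where
  "is_focal_element fa c \<longleftrightarrow> fa c = 1 \<and> (\<forall>a. fa a = 1 \<longrightarrow> c \<le> a)"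

locale c_ebl_algebra = ebl_algebra +
  assumes focal_element_exists: "\<exists>c. is_focal_element fa c"

definition constant_maps :: "('w \<Rightarrow> 'a) set" where
  "constant_maps = {f. \<exists>a. f = (\<lambda>w. a)}"

definition possibilistic_frame :: "'w set \<Rightarrow> ('w \<Rightarrow> 'a::complete_bl_chain) \<Rightarrow> bool" where
  "possibilistic_frame W \<pi> \<longleftrightarrow> W \<noteq> {} \<and> (SUP w\<in>W. \<pi> w) = 1"

definition frame_forall ::
    "'w set \<Rightarrow> ('w \<Rightarrow> 'a::complete_bl_chain) \<Rightarrow> ('w \<Rightarrow> 'a) \<Rightarrow> ('w \<Rightarrow> 'a)" where
  "frame_forall W \<pi> f = (\<lambda>v. INF w\<in>W. (\<pi> w \<leadsto> f w))"

definition frame_exists ::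
    "'w set \<Rightarrow> ('w \<Rightarrow> 'a::complete_bl_chain) \<Rightarrow> ('w \<Rightarrow> 'a) \<Rightarrow> ('w \<Rightarrow> 'a)" where
  "frame_exists W \<pi> f = (\<lambda>v. SUP w\<in>W. \<pi> w * f w)"

end

theory Submission
  imports Defs
begin

text \<open>
  Since the constant maps are exactly the values of \<open>\<forall>\<close>, the axioms
  \<open>\<forall>(\<forall>a \<leadsto> b) = \<forall>a \<leadsto> \<forall>b\<close> and \<open>\<forall>(a \<leadsto> \<forall>b) = \<exists>a \<leadsto> \<forall>b\<close> apply with any constant
  \<open>k\<close> in place of the quantified subterm. Moreover \<open>\<forall>g = 1\<close> holds iff \<open>c \<le> g\<close>. Hence
  \<open>k \<le> \<forall>f\<close> iff \<open>c \<le> k \<leadsto> f\<close>, which determines the constant map \<open>\<forall>f\<close>. Likewise, the value of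
  \<open>\<exists>f \<leadsto> k = \<forall>(f \<leadsto> k)\<close> at any point is \<open>1\<close> iff \<open>c * f \<le> k\<close>, which determines \<open>\<exists>f\<close> at that point.
\<close>

context bl_algebra
begin

lemma le_one: "a \<le> 1"
  by (simp add: one_is_top)

lemma one_le_residuum_iff: "1 \<le> (a \<leadsto> b) \<longleftrightarrow> a \<le> b"
  using residuation[of 1 a b] by simp

lemma residuum_eq_one_iff: "(a \<leadsto> b) = 1 \<longleftrightarrow> a \<le> b"
  using one_le_residuum_iff[of a b] le_one[of "a \<leadsto> b"] by (auto intro: order.antisym)

lemma le_residuum_commute: "a \<le> (b \<leadsto> c) \<longleftrightarrow> b \<le> (a \<leadsto> c)"
  by (metis residuation mult.commute)

end

lemma (in ebl_algebra) mono_fa: "mono fa"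
  by (metis fa_inf inf.absorb_iff1 monoI)

lemma (in ebl_algebra) fa_eq_one_iff:
  assumes "is_focal_element fa c"
  shows "fa a = 1 \<longleftrightarrow> c \<le> a"
  using assms monoD[OF mono_fa, of c a] le_one[of "fa a"]
  unfolding is_focal_element_def by (auto intro: order.antisym)

text \<open>By \<open>fa_fa_imp\<close>, the left side says
  \<open>fa (fa b \<leadsto> a) = 1\<close>, that is \<open>c \<le> (fa b \<leadsto> a)\<close>;
  residuation then swaps \<open>c\<close> and \<open>fa b\<close>.\<close>

lemma (in ebl_algebra) fa_le_fa_iff:
  assumes "is_focal_element fa c"
  shows "fa b \<le> fa a \<longleftrightarrow> fa b \<le> (c \<leadsto> a)"
  by (metis assms fa_eq_one_iff fa_fa_imp residuum_eq_one_iff le_residuum_commute)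

lemma le_frame_forall_iff:
  "k \<le> frame_forall UNIV c f v \<longleftrightarrow> (\<lambda>_. k) \<le> (c \<leadsto> f)"
  by (simp add: frame_forall_def le_INF_iff le_fun_def residuum_fun_def)

lemma fa_eq_frame_forall:
  fixes fa ex :: "('w \<Rightarrow> 'a::complete_bl_chain) \<Rightarrow> ('w \<Rightarrow> 'a)"
  assumes "ebl_algebra fa ex" and c: "is_focal_element fa c"
    and range: "range fa = constant_maps"
  shows "fa f = frame_forall UNIV c f"
proof
  interpret ebl_algebra fa ex by fact
  fix v
  obtain m where m: "fa f = (\<lambda>_. m)"
    using range unfolding constant_maps_def by blast
  \<comment> \<open>Elements with the same lower bounds are equal.\<close>
  have "k \<le> m \<longleftrightarrow> k \<le> frame_forall UNIV c f v" for k
  proof -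
    obtain b where b: "fa b = (\<lambda>_. k)"
      using range unfolding constant_maps_def by (metis (mono_tags) imageE mem_Collect_eq)
    show ?thesis
      using fa_le_fa_iff[OF c, of b f] unfolding le_frame_forall_iff b m by (simp add: le_fun_def)
  qed
  then show "fa f v = frame_forall UNIV c f v"
    unfolding m by (meson order.antisym order.refl)
qed

lemma ex_eq_frame_exists:
  fixes fa ex :: "('w \<Rightarrow> 'a::complete_bl_chain) \<Rightarrow> ('w \<Rightarrow> 'a)"
  assumes ebl: "ebl_algebra fa ex" and c: "is_focal_element fa c"
    and range: "range fa = constant_maps"
  shows "ex f = frame_exists UNIV c f"
proof
  interpret ebl_algebra fa ex by fact
  fix v
  \<comment> \<open>Comparing upper bounds at \<open>v\<close> alone yields constancy of
    \<open>ex f\<close> as a by-product.\<close>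
  have "ex f v \<le> k \<longleftrightarrow> frame_exists UNIV c f v \<le> k" for k
  proof -
    obtain b where b: "fa b = (\<lambda>_. k)"
      using range unfolding constant_maps_def by (metis (mono_tags) imageE mem_Collect_eq)
    have "ex f v \<le> k \<longleftrightarrow> 1 \<le> (ex f \<leadsto> (\<lambda>_. k)) v"
      by (simp add: residuum_fun_def one_le_residuum_iff)
    \<comment> \<open>\<open>fa_imp_fa\<close> reduces to the universal case, applied to
      \<open>f \<leadsto> (\<lambda>_. k)\<close>.\<close>
    also have "\<dots> \<longleftrightarrow> 1 \<le> frame_forall UNIV c (f \<leadsto> (\<lambda>_. k)) v"
      using fa_imp_fa[of f b, unfolded b] by (simp add: fa_eq_frame_forall[OF ebl c range])
    also have "\<dots> \<longleftrightarrow> (\<forall>w. c w * f w \<le> k)"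
      by (simp add: le_frame_forall_iff le_fun_def residuum_fun_def one_le_residuum_iff residuation)
    finally show ?thesis
      by (simp add: frame_exists_def SUP_le_iff)
  qed
  then show "ex f v = frame_exists UNIV c f v"
    by (meson order.antisym order.refl)
qed

theorem theorem11:
  fixes fa ex :: "('w \<Rightarrow> 'a::complete_bl_chain) \<Rightarrow> ('w \<Rightarrow> 'a)"
    and c :: "'w \<Rightarrow> 'a"
  assumes "c_ebl_algebra fa ex"
    and "is_focal_element fa c"
    and "(SUP w. c w) = 1"
    and "range fa = constant_maps"
  shows "possibilistic_frame UNIV c
    \<and> frame_forall UNIV c = fa
    \<and> frame_exists UNIV c = ex"
proof -
  have ebl: "ebl_algebra fa ex"
    using assms(1) by (simp add: c_ebl_algebra_def)
  show ?thesis
    using assms(3) fa_eq_frame_forall[OF ebl assms(2,4)] ex_eq_frame_exists[OF ebl assms(2,4)]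
    by (simp add: possibilistic_frame_def fun_eq_iff)
qed

end
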